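(* The following thirteen functions of the complex variable $p$ are equal to one another in a neighborhood of $p=0$. (Level 1) 1. $\dfrac{1}{(1+236p+1440p^2+1920p^3+3840p^4+256p^5+256p^6)^{1/2}}\,F_1\!\left(\dfrac{p(1-4p)^{10}(1+p)^5}{(1+236p+1440p^2+1920p^3+3840p^4+256p^5+256p^6)^3}\right)$ 2. $\dfrac{1}{(1-4p+240p^2-480p^3+1440p^4-944p^5+16p^6)^{1/2}}\,F_1\!\left(\dfrac{p^2(1-4p)^5(1+p)^{10}}{(1-4p+240p^2-480p^3+1440p^4-944p^5+16p^6)^3}\right)$ 3. $\dfrac{1}{(1-4p+256p^5+256p^6)^{1/2}}\,F_1\!\left(\dfrac{p^5(1-4p)^2(1+p)}{(1-4p+256p^5+256p^6)^3}\right)$ 4. $\dfrac{1}{(1-4p+16p^5+16p^6)^{1/2}}\,F_1\!\left(\dfrac{p^{10}(1-4p)(1+p)^2}{(1-4p+16p^5+16p^6)^3}\right)$ (Level 2) 5. $\dfrac{1}{(1+4p^2)^{1/2}(1+22p-4p^2)}\,F_2\!\left(\dfrac{p(1+p)^5(1-4p)^5}{(1+4p^2)^2(1+22p-4p^2)^4}\right)$ 6. $\dfrac{1}{(1+4p^2)^{1/2}(1-2p-4p^2)}\,F_2\!\left(\dfrac{p^5(1+p)(1-4p)}{(1+4p^2)^2(1-2p-4p^2)^4}\right)$ (Level 4) 7. $\dfrac{1}{(1-4p)^{5/2}}\,F_4\!\left(-p\left(\dfrac{1+p}{1-4p}\right)^5\right)$ 8. $\dfrac{1}{(1-4p)^{1/2}}\,F_4\!\left(-p^5\left(\dfrac{1+p}{1-4p}\right)\right)$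 (Level 5, functions $F$) 9. $\dfrac{1}{(1+4p^2)^{1/2}(1+4p+8p^2)}\,F_5\!\left(\dfrac{p(1-4p)^2(1+p)}{(1+4p^2)(1+4p+8p^2)^2}\right)$ 10. $\dfrac{1}{(1+4p^2)^{1/2}(1-2p+2p^2)}\,F_5\!\left(\dfrac{p^2(1-4p)(1+p)^2}{(1+4p^2)(1-2p+2p^2)^2}\right)$ (Level 5, functions $G$) 11. $\dfrac{1}{(1+p)(1-4p)^2}\,G_5\!\left(\left(\dfrac{p}{1+p}\right)\left(\dfrac{1}{1-4p}\right)^2\right)$ 12. $\dfrac{1}{(1+p)^2(1-4p)}\,G_5\!\left(\left(\dfrac{p}{1+p}\right)^2\left(\dfrac{1}{1-4p}\right)\right)$ (Level 10, function $H$) 13. $\dfrac{1}{(1+4p^2)^{3/2}}\,H\!\left(\dfrac{p(1+p)(1-4p)}{(1+4p^2)^2}\right)$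
   Context: Fractional powers denote the branch equal to $1$ at $p=0$. The functions are defined by power series convergent near $0$: $$F_1(x)=\sum_{n\ge0}\binom{6n}{3n}\binom{3n}{2n}\binom{2n}{n}x^n,\quad F_2(x)=\sum_{n\ge0}\binom{4n}{2n}\binom{2n}{n}^2x^n,\quad F_4(x)=\sum_{n\ge0}\binom{2n}{n}^3x^n.$$ Define sequences $t(n)$ and $T(n)$ by $t(0)=T(0)=1$ and, for all integers $n\ge0$, with $(\alpha,\beta,\gamma)=(11,3,1)$, $$(n+1)^2t(n+1)=(\alpha n^2+\alpha n+\beta)t(n)+\gamma n^2t(n-1),$$ $$(n+1)^3T(n+1)=-(2n+1)(\alpha n^2+\alpha n+\alpha-2\beta)T(n)-(\alpha^2+4\gamma)n^3T(n-1)$$ (for $n=0$ the last terms vanish). Put $$F_5(x)=\sum_{n\ge0}\binom{2n}{n}t(n)x^n,\qquad G_5(x)=\sum_{n\ge0}T(n)x^n,\qquad H(x)=\sum_{n\ge0}\left\{\sum_{j=0}^n\binom{n}{j}^4\right\}x^n.$$ *)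

theory Defs
  imports "HOL-Analysis.Analysis"
begin

text \<open>
  The recurrences are solved for the highest term. For \<open>n = 0\<close> the truncated index \<open>n - 1\<close> is
  harmless, since its coefficient vanishes; the recurrences in their usual form are proved below.
\<close>

fun seq_t :: "complex \<Rightarrow> complex \<Rightarrow> complex \<Rightarrow> nat \<Rightarrow> complex" where
  "seq_t \<alpha> \<beta> \<gamma> 0 = 1"
| "seq_t \<alpha> \<beta> \<gamma> (Suc n) =
     ((\<alpha> * of_nat n ^ 2 + \<alpha> * of_nat n + \<beta>) * seq_t \<alpha> \<beta> \<gamma> n
       + \<gamma> * of_nat n ^ 2 * seq_t \<alpha> \<beta> \<gamma> (n - 1)) / (of_nat n + 1) ^ 2"

fun seq_T :: "complex \<Rightarrow> complex \<Rightarrow> complex \<Rightarrow> nat \<Rightarrow> complex" where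
  "seq_T \<alpha> \<beta> \<gamma> 0 = 1"
| "seq_T \<alpha> \<beta> \<gamma> (Suc n) =
     (- (2 * of_nat n + 1) * (\<alpha> * of_nat n ^ 2 + \<alpha> * of_nat n + \<alpha> - 2 * \<beta>) * seq_T \<alpha> \<beta> \<gamma> n
       - (\<alpha> ^ 2 + 4 * \<gamma>) * of_nat n ^ 3 * seq_T \<alpha> \<beta> \<gamma> (n - 1)) / (of_nat n + 1) ^ 3"

lemma seq_t_recurrence:
  "(of_nat n + 1) ^ 2 * seq_t \<alpha> \<beta> \<gamma> (n + 1) =
     (\<alpha> * of_nat n ^ 2 + \<alpha> * of_nat n + \<beta>) * seq_t \<alpha> \<beta> \<gamma> n
       + \<gamma> * of_nat n ^ 2 * seq_t \<alpha> \<beta> \<gamma> (n - 1)"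
proof -
  have "(of_nat n + 1 :: complex) \<noteq> 0"
    using of_nat_neq_0[of n, where ?'a = complex] by (simp add: add.commute)
  then show ?thesis by simp
qed

lemma seq_T_recurrence:
  "(of_nat n + 1) ^ 3 * seq_T \<alpha> \<beta> \<gamma> (n + 1) =
     - (2 * of_nat n + 1) * (\<alpha> * of_nat n ^ 2 + \<alpha> * of_nat n + \<alpha> - 2 * \<beta>) * seq_T \<alpha> \<beta> \<gamma> n
       - (\<alpha> ^ 2 + 4 * \<gamma>) * of_nat n ^ 3 * seq_T \<alpha> \<beta> \<gamma> (n - 1)"
proof -
  have "(of_nat n + 1 :: complex) \<noteq> 0"
    using of_nat_neq_0[of n, where ?'a = complex] by (simp add: add.commute)
  then show ?thesis by simp
qed

text \<open>
  The power series converge near 0. Fractional powers are taken with the principal complex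
  \<open>powr\<close>; for bases equal to 1 at \<open>p = 0\<close> this is, near 0, the branch equal to 1 there.
\<close>

definition F1 :: "complex \<Rightarrow> complex" where
  "F1 x = (\<Sum>n. of_nat (((6 * n) choose (3 * n)) * ((3 * n) choose (2 * n)) * ((2 * n) choose n)) * x ^ n)"

definition F2 :: "complex \<Rightarrow> complex" where
  "F2 x = (\<Sum>n. of_nat (((4 * n) choose (2 * n)) * ((2 * n) choose n) ^ 2) * x ^ n)"

definition F4 :: "complex \<Rightarrow> complex" where
  "F4 x = (\<Sum>n. of_nat (((2 * n) choose n) ^ 3) * x ^ n)"

definition F5 :: "complex \<Rightarrow> complex" where
  "F5 x = (\<Sum>n. of_nat ((2 * n) choose n) * seq_t 11 3 1 n * x ^ n)"

definition G5 :: "complex \<Rightarrow> complex" where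
  "G5 x = (\<Sum>n. seq_T 11 3 1 n * x ^ n)"

definition H :: "complex \<Rightarrow> complex" where
  "H x = (\<Sum>n. of_nat (\<Sum>j = 0..n. (n choose j) ^ 4) * x ^ n)"

end

theory Submission
  imports Defs "HOL-Complex_Analysis.Complex_Analysis"
begin

text \<open>
  Each of the thirteen functions has the form \<open>a(p) F(x(p))\<close> with \<open>F\<close> one of six power series, \<open>x\<close> a
  rational function vanishing at 0, and \<open>a^(-2)\<close> a polynomial. They agree because they all are
  the unique power series with constant term 1 that solves one differential equation.

  The coefficients of all six series satisfy recurrences of one shape,
  \<open>(n + 1)^3 u(n + 1) = (2 n + 1) (A n^2 + A n + B) u(n) + n (C n^2 + E) u(n - 1)\<close>.
  For four of them this is immediate from factorials or from the definition, for \<open>F5\<close> it follows from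
  the recurrence of its sporadic factor, and for the sums of fourth powers of binomials in
  \<open>H\<close> it is proved by creative telescoping (\<open>sum_binomial_fourth_recurrence\<close>). The corresponding
  third-order differential operator is the symmetric square of a second-order one
  (\<open>recurrence_imp_first_integral_ode\<close>). Thus the square root of the series solves an equation
  \<open>D (D v) = (q / 4) v\<close>, where \<open>D = sqrt s * \<theta>\<close>, \<open>\<theta> = x d/dx\<close>, and \<open>s\<close> and \<open>q\<close> are polynomials of degree at
  most two in \<open>x\<close>.

  Under a substitution \<open>x = x(p)\<close> and multiplication by \<open>a\<close> this type of equation is preserved as soon
  as \<open>a\<close> is matched to the change of \<open>D\<close> (\<open>first_integral_ode_pullback\<close>). In all thirteen cases it is,
  and the result is the same equation, with \<open>S = ((1 + p) (1 - 4 p))^2 (1 + 4 p^2)\<close> and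
  \<open>Q = 4 (p - 15 p^4 - 160 p^5 - 144 p^6)\<close>; each case amounts to three polynomial identities. Since all
  exponents of the third-order equation at 0 vanish, its power series solution is determined
  by its constant term (\<open>first_integral_ode_unique\<close>).

  The argument takes place in formal power series over the complex numbers. The recurrences give
  geometric bounds for the coefficients, so the six series converge near 0, and identities of
  expansions become identities of functions near 0 (\<open>common_germI\<close>, \<open>common_germ_unique\<close>).
\<close>

section \<open>The Euler derivation on formal power series\<close>

abbreviation euler :: "complex fps \<Rightarrow> complex fps" ("\<theta>") where "\<theta> \<equiv> fps_XD"

lemma euler_diff: "\<theta> (f - g) = \<theta> f - \<theta> g"
  by (simp add: fps_eq_iff algebra_simps)

lemma euler_mult: "\<theta> (f * g) = \<theta> f * g + f * \<theta> g"
  by (simp add: fps_XD_def algebra_simps)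

lemma euler_uminus: "\<theta> (- f) = - \<theta> f"
  by (simp add: fps_eq_iff)

lemma euler_numeral: "\<theta> (numeral k) = 0" "\<theta> 1 = 0" "\<theta> 0 = 0" "\<theta> (fps_const c) = 0"
  by (simp_all add: fps_XD_def numeral_fps_const)

lemma euler_X: "\<theta> fps_X = fps_X"
  by (simp add: fps_XD_def)

lemma euler_power: "\<theta> (f ^ n) = of_nat n * f ^ (n - 1) * \<theta> f"
  by (simp add: fps_XD_def fps_deriv_power fps_of_nat)

lemma euler_power_numeral: "\<theta> (f ^ numeral k) = numeral k * f ^ pred_numeral k * \<theta> f"
  by (simp only: euler_power pred_numeral_def of_nat_numeral)

text \<open>
  These rules expand the Euler derivative of an explicit polynomial in \<open>fps_X\<close> completely, including
  the exponent arithmetic, so that what remains is a ring identity in one indeterminate.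
\<close>
lemmas euler_eval = fps_XD_add euler_diff euler_mult euler_uminus euler_numeral euler_X
  euler_power_numeral pred_numeral_simps BitM.simps numeral_One power_one_right

lemmas euler_simps = fps_XD_add euler_diff euler_mult euler_uminus euler_numeral euler_X euler_power

lemma euler_compose:
  assumes "fps_nth X 0 = 0" "\<theta> X = r * X"
  shows "\<theta> (f oo X) = r * (\<theta> f oo X)"
  using assms by (simp add: fps_XD_def fps_compose_deriv fps_compose_mult_distrib algebra_simps)

section \<open>Symmetric squares and their first integral\<close>

text \<open>
  Put \<open>D = sqrt S * \<theta>\<close>. If \<open>v\<close> and \<open>w\<close> solve \<open>D (D v) = (Q / 4) v\<close>, then \<open>z = v * w\<close> solves
  \<open>D (D (D z)) = Q * D z + (1/2) D Q * z\<close>. Twice this symmetric square, divided by \<open>sqrt S\<close>, is the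
  equation below; the square root disappears because \<open>D (D f) = S \<theta> (\<theta> f) + (1/2) \<theta> S \<theta> f\<close>.
\<close>
definition sym_square_ode :: "complex fps \<Rightarrow> complex fps \<Rightarrow> complex fps \<Rightarrow> bool" where
  "sym_square_ode S Q z \<longleftrightarrow>
     2 * S * \<theta> (\<theta> (\<theta> z)) + 3 * \<theta> S * \<theta> (\<theta> z) + \<theta> (\<theta> S) * \<theta> z = 2 * Q * \<theta> z + \<theta> Q * z"

text \<open>
  The expression \<open>2 z D (D z) - (D z)^2 - Q z^2\<close> is constant on solutions of the symmetric square (it is
  minus the square of a Wronskian), and it vanishes on the solutions that are regular at the singular
  point 0. This equation of order two, which says that \<open>sqrt z\<close> solves \<open>D (D v) = (Q / 4) v\<close>, is the
  form that transforms well under substitutions.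
\<close>
definition first_integral_ode :: "complex fps \<Rightarrow> complex fps \<Rightarrow> complex fps \<Rightarrow> bool" where
  "first_integral_ode S Q z \<longleftrightarrow>
     2 * S * z * \<theta> (\<theta> z) + \<theta> S * z * \<theta> z - S * (\<theta> z)^2 = Q * z^2"

lemma euler_eq_0_imp_eq_0:
  assumes "\<theta> f = 0" "fps_nth f 0 = 0" shows "f = 0"
proof (rule fps_ext)
  fix n
  have "of_nat n * fps_nth f n = 0" using assms(1) by (metis fps_XD_nth fps_zero_nth)
  then show "fps_nth f n = fps_nth 0 n" using assms(2) by (cases n) (simp_all del: of_nat_Suc)
qed

text \<open>
  Differentiating the first integral gives \<open>z\<close> times the third-order equation, and the constant of
  integration is zero because \<open>Q\<close> and all Euler derivatives have constant term 0.
\<close>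
lemma first_integral_iff:
  assumes z: "fps_nth z 0 \<noteq> 0" and Q: "fps_nth Q 0 = 0"
  shows "first_integral_ode S Q z \<longleftrightarrow> sym_square_ode S Q z"
proof -
  define I where "I = 2 * S * z * \<theta> (\<theta> z) + \<theta> S * z * \<theta> z - S * (\<theta> z)^2 - Q * z^2"
  define J where "J = 2 * S * \<theta> (\<theta> (\<theta> z)) + 3 * \<theta> S * \<theta> (\<theta> z) + \<theta> (\<theta> S) * \<theta> z
                        - 2 * Q * \<theta> z - \<theta> Q * z"
  have "\<theta> I = z * J"
    unfolding I_def J_def by (simp add: euler_simps) algebra
  moreover have "fps_nth I 0 = 0"
    by (simp add: I_def Q power2_eq_square)
  moreover have "z \<noteq> 0" using z by auto
  ultimately have "I = 0 \<longleftrightarrow> J = 0"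
    using euler_eq_0_imp_eq_0[of I] by (auto simp: euler_numeral)
  then show ?thesis
    by (simp add: first_integral_ode_def sym_square_ode_def I_def J_def algebra_simps)
qed

lemma fps_nth_mult_lowest:
  assumes "\<And>i. i < n \<Longrightarrow> fps_nth g i = 0"
  shows "fps_nth (f * g) n = fps_nth f 0 * (fps_nth g n :: complex)"
proof -
  have "fps_nth (f * g) n = (\<Sum>i\<in>{0}. fps_nth f i * fps_nth g (n - i))"
    unfolding fps_mult_nth by (rule sum.mono_neutral_right) (use assms in auto)
  then show ?thesis by simp
qed

text \<open>
  All three exponents of the third-order equation at 0 are zero: if the coefficients of \<open>d\<close> below \<open>n\<close>
  vanish, then the \<open>n\<close>-th coefficient of the equation reads \<open>2 n^3 d_n = 0\<close>.
\<close>
lemma sym_square_ode_zero: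
  assumes ode: "sym_square_ode S Q d" and S: "fps_nth S 0 = 1" and Q: "fps_nth Q 0 = 0"
    and d: "fps_nth d 0 = 0"
  shows "d = 0"
proof (rule fps_ext)
  fix n
  show "fps_nth d n = fps_nth 0 n"
  proof (induction n rule: less_induct)
    case (less n)
    then have low: "fps_nth d i = 0" if "i < n" for i using that by simp
    have "fps_nth (2 * (S * \<theta> (\<theta> (\<theta> d)))) n + fps_nth (3 * (\<theta> S * \<theta> (\<theta> d))) n 
        + fps_nth (\<theta> (\<theta> S) * \<theta> d) n
        = fps_nth (2 * (Q * \<theta> d)) n + fps_nth (\<theta> Q * d) n"
      using arg_cong[OF ode[unfolded sym_square_ode_def], of "\<lambda>f. fps_nth f n"] 
      by (simp only: fps_add_nth mult.assoc)
    then have "2 * of_nat n ^ 3 * fps_nth d n = 0"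
      by (simp add: numeral_fps_const fps_nth_mult_lowest low S Q power3_eq_cube)
    then show ?case using d by (cases "n = 0") auto
  qed
qed

text \<open>Uniqueness is read off from the third-order equation because that one is linear.\<close>
lemma first_integral_ode_unique:
  assumes "first_integral_ode S Q y" "first_integral_ode S Q z"
    and S: "fps_nth S 0 = 1" and Q: "fps_nth Q 0 = 0" and "fps_nth y 0 = 1" "fps_nth z 0 = 1"
  shows "y = z"
proof -
  have "sym_square_ode S Q y" "sym_square_ode S Q z"
    using assms first_integral_iff by auto
  then have "sym_square_ode S Q (y - z)"
    unfolding sym_square_ode_def by (simp add: euler_diff) algebra
  then have "y - z = 0"
    by (rule sym_square_ode_zero) (use assms in auto)
  then show ?thesis by simp
qed

section \<open>Pullbacks\<close>

text \<open>
  The operator \<open>D = sqrt S * \<theta>\<close> in the new variable must be a multiple of the old \<open>sqrt s * \<theta>\<close>. With the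
  logarithmic derivative \<open>r = R / g\<close> of the substitution this is the hypothesis on \<open>S\<close>, squared to keep
  everything rational. The multiplier is \<open>1 / a\<close> up to a constant, and for exactly this weight
  the substitution \<open>z = a F(X)\<close> creates no new first-order term in the equation for \<open>sqrt z\<close>; the
  hypothesis on \<open>Q\<close> is what happens to the potential, the analogue of the Schwarzian derivative. Only
  \<open>b = 1 / a^2\<close> enters, so no fractional power occurs in the hypotheses.
\<close>
lemma first_integral_ode_pullback:
  fixes a b c g R X S Q s q F :: "complex fps"
  assumes F: "first_integral_ode s q F"
    and X0: "fps_nth X 0 = 0" and g0: "fps_nth g 0 \<noteq> 0" and R0: "fps_nth R 0 \<noteq> 0"
    and b0: "fps_nth b 0 \<noteq> 0" and c: "\<theta> c = 0"
    and ab: "a^2 * b = 1"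
    and X: "g * \<theta> X = R * X"
    and S: "S * R^2 = c * (s oo X) * b * g^2"
    and Q: "4 * Q * b^2 = 4 * c * (q oo X) * b^3 - 4 * S * b * \<theta> (\<theta> b)
              + 5 * S * (\<theta> b)^2 - 2 * \<theta> S * b * \<theta> b"
  shows "first_integral_ode S Q (a * (F oo X))"
proof -
  define r where "r = R * inverse g"
  have gr: "g * r = R"
    using g0 by (simp add: r_def mult.left_commute[of g] inverse_mult_eq_1')
  have nz: "g \<noteq> 0" "R \<noteq> 0" "b \<noteq> 0" using g0 R0 b0 by auto
  then have "r \<noteq> 0" using gr by auto
  have rX: "\<theta> X = r * X"
    using X nz(1) unfolding gr[symmetric] by (simp add: mult.assoc)
  \<comment> \<open>Logarithmic derivatives turn all hypotheses into polynomial relations: with \<open>L\<close> that of \<open>b\<close>,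
      the one of \<open>a\<close> is \<open>- L / 2\<close>.\<close>
  define L where "L = \<theta> b * inverse b"
  have L: "\<theta> b = L * b"
    using b0 by (simp add: L_def mult.assoc inverse_mult_eq_1)
  define f f1 f2 sX s1 qX where defs: "f = F oo X" "f1 = \<theta> F oo X" "f2 = \<theta> (\<theta> F) oo X"
    "sX = s oo X" "s1 = \<theta> s oo X" "qX = q oo X"
  have d: "\<theta> f = r * f1" "\<theta> f1 = r * f2" "\<theta> sX = r * s1"
    unfolding defs by (simp_all add: euler_compose[OF X0 rX])
  have Ff: "2 * sX * f * f2 + s1 * f * f1 - sX * f1^2 = qX * f^2"
  proof -
    have "(2 * s * F * \<theta> (\<theta> F) + \<theta> s * F * \<theta> F - s * (\<theta> F)^2) oo X = (q * F^2) oo X"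
      using F by (simp add: first_integral_ode_def)
    then show ?thesis
      by (simp add: fps_compose_add_distrib fps_compose_sub_distrib fps_compose_mult_distrib[OF X0]
           fps_compose_power[OF X0] numeral_fps_const defs)
  qed
  have Sr: "S * r^2 = c * sX * b"
  proof -
    have "(S * r^2) * g^2 = (c * sX * b) * g^2"
      using S unfolding gr[symmetric] defs by (simp add: power_mult_distrib algebra_simps)
    then show ?thesis using nz by simp
  qed
  \<comment> \<open>The derivative of the weight relation, divided by \<open>r\<close>, removes \<open>\<theta> r\<close> from the mixed term.\<close>
  have dSr: "r * \<theta> S + 2 * S * \<theta> r = c * s1 * b + S * r * L"
  proof -
    have "\<theta> (S * r^2) = \<theta> (c * sX * b)" using Sr by simp
    then have "\<theta> S * r^2 + 2 * S * r * \<theta> r = c * (r * s1) * b + c * sX * (L * b)"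
      by (simp add: euler_simps c d L algebra_simps power2_eq_square)
    then have "r * (r * \<theta> S + 2 * S * \<theta> r) = r * (c * s1 * b + S * r * L)"
      using Sr by algebra
    then show ?thesis using \<open>r \<noteq> 0\<close> by simp
  qed
  have Q': "4 * Q = 4 * c * qX * b - 4 * S * \<theta> L + S * L^2 - 2 * \<theta> S * L"
  proof -
    have "\<theta> (\<theta> b) = \<theta> L * b + L^2 * b"
      by (simp add: L euler_simps power2_eq_square algebra_simps)
    then have "b^2 * (4 * Q) = b^2 * (4 * c * qX * b - 4 * S * \<theta> L + S * L^2 - 2 * \<theta> S * L)"
      using Q unfolding defs(6)[symmetric] L by algebra
    then show ?thesis using nz by simp
  qed
  have da: "2 * \<theta> a = - L * a"
  proof -
    have "a \<noteq> 0" using ab by auto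
    have "\<theta> (a^2 * b) = 0" by (simp add: ab euler_simps)
    then have "(a * b) * (2 * \<theta> a) = (a * b) * (- L * a)"
      by (simp add: euler_simps L power2_eq_square) algebra
    then show ?thesis using nz \<open>a \<noteq> 0\<close> by (metis mult_left_cancel mult_eq_0_iff)
  qed
  have dda: "4 * \<theta> (\<theta> a) = (L^2 - 2 * \<theta> L) * a"
  proof -
    have "\<theta> (2 * \<theta> a) = \<theta> (- L * a)" using da by simp
    then have "2 * \<theta> (\<theta> a) = - \<theta> L * a - L * \<theta> a" by (simp add: euler_simps)
    then show ?thesis using da by algebra
  qed
  define z where "z = a * f"
  have dz: "2 * \<theta> z = a * (2 * r * f1 - L * f)"
    unfolding z_def using da by (simp add: euler_simps d) algebra
  have ddz: "4 * \<theta> (\<theta> z) = a * ((L^2 - 2 * \<theta> L) * f + (4 * \<theta> r - 4 * L * r) * f1 + 4 * r^2 * f2)"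
  proof -
    have "\<theta> (\<theta> z) = \<theta> (\<theta> a) * f + 2 * \<theta> a * r * f1 + a * \<theta> r * f1 + a * r^2 * f2"
      unfolding z_def by (simp add: euler_simps d algebra_simps power2_eq_square)
    then show ?thesis using da dda by algebra
  qed
  define I where "I = 2 * S * z * \<theta> (\<theta> z) + \<theta> S * z * \<theta> z - S * (\<theta> z)^2 - Q * z^2"
  have "4 * I = 2 * S * z * (4 * \<theta> (\<theta> z)) + 2 * \<theta> S * z * (2 * \<theta> z) - S * (2 * \<theta> z)^2 - 4 * Q * z^2"
    by (simp add: I_def algebra_simps power2_eq_square)
  also have "\<dots> = a^2 * (4 * (S * r^2) * (2 * f * f2 - f1^2)
       + 4 * f * f1 * (r * \<theta> S + 2 * S * \<theta> r - S * r * L)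
       - f^2 * (4 * Q + 4 * S * \<theta> L - S * L^2 + 2 * \<theta> S * L))"
    unfolding dz ddz unfolding z_def by algebra
  also have "\<dots> = 4 * a^2 * c * b * (2 * sX * f * f2 + s1 * f * f1 - sX * f1^2 - qX * f^2)"
    unfolding Sr dSr Q' by algebra
  also have "\<dots> = 0" by (simp add: Ff)
  finally have "I = 0" by simp
  then show ?thesis
    by (simp add: first_integral_ode_def I_def z_def[symmetric] defs(1)[symmetric])
qed

section \<open>The recurrence shared by the six sequences\<close>

text \<open>
  Every coefficient sequence of the theorem satisfies a recurrence of this shape. Exactly this
  shape makes the differential equation of the generating function a symmetric square, with \<open>S\<close> and \<open>Q\<close>
  polynomials of degree at most two.
\<close>
definition sporadic_recurrence :: "complex \<Rightarrow> complex \<Rightarrow> complex \<Rightarrow> complex \<Rightarrow> (nat \<Rightarrow> complex) \<Rightarrow> bool" where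
  "sporadic_recurrence A B C E u \<longleftrightarrow> u 0 = 1 \<and>
     (\<forall>n. (of_nat n + 1)^3 * u (n + 1) =
        (2 * of_nat n + 1) * (A * of_nat n^2 + A * of_nat n + B) * u n
        + of_nat n * (C * of_nat n^2 + E) * u (n - 1))"

text \<open>
  The linear form of the equation is compared with the recurrence coefficientwise. A shift by one
  turns \<open>\<theta>\<close> into \<open>n - 1\<close> and a shift by two into \<open>n - 2\<close>, hence the regrouping by powers of \<open>fps_X\<close>.
\<close>
lemma recurrence_imp_first_integral_ode:
  assumes "sporadic_recurrence A B C E u"
  shows "first_integral_ode (1 - fps_const (2 * A) * fps_X - fps_const C * fps_X^2)
           (fps_const (2 * B) * fps_X + fps_const (C + E) * fps_X^2) (Abs_fps u)"
proof (subst first_integral_iff)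
  let ?u = "Abs_fps u"
  have u0: "u 0 = 1" and rec: "\<And>n. (of_nat n + 1)^3 * u (n + 1) =
        (2 * of_nat n + 1) * (A * of_nat n^2 + A * of_nat n + B) * u n
        + of_nat n * (C * of_nat n^2 + E) * u (n - 1)"
    using assms by (auto simp: sporadic_recurrence_def)
  have nth_X: "fps_nth (fps_const a * fps_X * f) n = (if n = 0 then 0 else a * fps_nth f (n - 1))"
    and nth_X2: "fps_nth (fps_const a * fps_X^2 * f) n = (if n < 2 then 0 else a * fps_nth f (n - 2))"
    for a :: complex and f n
    by (simp_all add: mult.assoc fps_X_power_mult_nth)
  let ?S = "1 - fps_const (2 * A) * fps_X - fps_const C * fps_X^2"
  let ?Q = "fps_const (2 * B) * fps_X + fps_const (C + E) * fps_X^2"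
  have eq: "2 * ?S * \<theta> (\<theta> (\<theta> f)) + 3 * \<theta> ?S * \<theta> (\<theta> f) + \<theta> (\<theta> ?S) * \<theta> f - (2 * ?Q * \<theta> f + \<theta> ?Q * f)
     = fps_const 2 * \<theta> (\<theta> (\<theta> f)) 
       - fps_const (2 * A) * fps_X * (2 * \<theta> (\<theta> (\<theta> f)) + 3 * \<theta> (\<theta> f) + \<theta> f)
       - fps_const (2 * B) * fps_X * (2 * \<theta> f + f)
       - fps_const C * fps_X^2 * (2 * \<theta> (\<theta> (\<theta> f)) + 6 * \<theta> (\<theta> f) + 4 * \<theta> f)
       - fps_const (C + E) * fps_X^2 * (2 * \<theta> f + 2 * f)" for f
    by (simp add: euler_simps numeral_fps_const[symmetric] del: fps_const_mult fps_const_add) algebra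
  have "2 * ?S * \<theta> (\<theta> (\<theta> ?u)) + 3 * \<theta> ?S * \<theta> (\<theta> ?u) + \<theta> (\<theta> ?S) * \<theta> ?u
           - (2 * ?Q * \<theta> ?u + \<theta> ?Q * ?u) = 0"
    unfolding eq
  proof (rule fps_ext)
    fix n
    show "fps_nth (fps_const 2 * \<theta> (\<theta> (\<theta> ?u)) 
       - fps_const (2 * A) * fps_X * (2 * \<theta> (\<theta> (\<theta> ?u)) + 3 * \<theta> (\<theta> ?u) + \<theta> ?u)
       - fps_const (2 * B) * fps_X * (2 * \<theta> ?u + ?u)
       - fps_const C * fps_X^2 * (2 * \<theta> (\<theta> (\<theta> ?u)) + 6 * \<theta> (\<theta> ?u) + 4 * \<theta> ?u)
       - fps_const (C + E) * fps_X^2 * (2 * \<theta> ?u + 2 * ?u)) n = fps_nth 0 n"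
    proof (cases n)
      case (Suc m)
      show ?thesis
      proof (cases m)
        case 0
        then show ?thesis using Suc rec[of 0]
          by (simp add: nth_X nth_X2 numeral_fps_const algebra_simps)
      next
        case (Suc k)
        let ?N = "of_nat k :: complex"
        have "(?N + 2)^3 * u (Suc (Suc k)) =
            (2 * ?N + 3) * (A * (?N + 1)^2 + A * (?N + 1) + B) * u (Suc k)
            + (?N + 1) * (C * (?N + 1)^2 + E) * u k"
          using rec[of "Suc k"] by (simp add: algebra_simps)
        then show ?thesis
          by (simp add: \<open>n = Suc m\<close> Suc nth_X nth_X2 numeral_fps_const) algebra
      qed
    qed (simp_all add: nth_X nth_X2)
  qed
  then show "sym_square_ode ?S ?Q ?u" by (simp add: sym_square_ode_def)
qed (use assms in \<open>auto simp: sporadic_recurrence_def\<close>)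

lemma recurrence_imp_geometric_bound:
  assumes "sporadic_recurrence A B C E u"
  shows "\<exists>K>0. \<forall>n. norm (u n) \<le> K ^ n"
proof -
  define K1 where "K1 = 2 * (norm A + norm B)"
  define K2 where "K2 = norm C + norm E"
  define K where "K = 1 + K1 + K2"
  have K: "K1 \<ge> 0" "K2 \<ge> 0" "K \<ge> 1" by (auto simp: K1_def K2_def K_def)
  have step: "norm (u (n + 1)) \<le> K1 * norm (u n) + K2 * norm (u (n - 1))" for n
  proof -
    let ?m = "real n + 1"
    have "?m^3 * norm (u (n + 1)) = norm ((of_nat n + 1)^3 * u (n + 1))"
      by (simp add: norm_mult norm_power) (metis abs_of_nonneg norm_of_nat of_nat_0_le_iff of_nat_Suc add.commute)
    also have "\<dots> \<le> norm ((2 * of_nat n + 1) * (A * of_nat n^2 + A * of_nat n + B)) * norm (u n)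
        + norm (of_nat n * (C * of_nat n^2 + E)) * norm (u (n - 1))"
      using assms unfolding sporadic_recurrence_def by (metis norm_mult norm_triangle_ineq)
    also have "norm ((2 * of_nat n + 1) * (A * of_nat n^2 + A * of_nat n + B)) \<le> ?m^3 * K1"
    proof -
      have "norm (2 * of_nat n + 1 :: complex) \<le> 2 * ?m"
        using norm_triangle_ineq[of "2 * of_nat n" "1::complex"] by (simp add: norm_mult)
      moreover have "norm (A * of_nat n^2 + A * of_nat n + B) \<le> ?m^2 * (norm A + norm B)"
      proof -
        have "norm (A * of_nat n^2 + A * of_nat n + B) \<le> norm A * real n^2 + norm A * real n + norm B"
          by (rule norm_triangle_le norm_triangle_mono add_mono order_refl | simp add: norm_mult norm_power)+
        also have "\<dots> \<le> (norm A + norm B) * ?m^2"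
          by (simp add: algebra_simps power2_eq_square)
        finally show ?thesis by (simp add: mult.commute)
      qed
      ultimately have "norm ((2 * of_nat n + 1) * (A * of_nat n^2 + A * of_nat n + B))
          \<le> 2 * ?m * (?m^2 * (norm A + norm B))"
        unfolding norm_mult by (intro mult_mono) auto
      then show ?thesis by (simp add: K1_def power2_eq_square power3_eq_cube algebra_simps)
    qed
    also have "norm (of_nat n * (C * of_nat n^2 + E)) \<le> ?m^3 * K2"
    proof -
      have "norm (C * of_nat n^2 + E) \<le> norm C * real n^2 + norm E"
        by (rule norm_triangle_le norm_triangle_mono add_mono order_refl | simp add: norm_mult norm_power)+
      also have "\<dots> \<le> ?m^2 * K2"
        by (simp add: K2_def algebra_simps power2_eq_square)
      finally have "norm (of_nat n * (C * of_nat n^2 + E)) \<le> ?m * (?m^2 * K2)"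
        unfolding norm_mult by (intro mult_mono) auto
      then show ?thesis by (simp add: power2_eq_square power3_eq_cube algebra_simps)
    qed
    finally have "?m^3 * norm (u (n + 1)) \<le> ?m^3 * (K1 * norm (u n) + K2 * norm (u (n - 1)))"
      by (simp add: algebra_simps mult_right_mono)
    then show ?thesis by simp
  qed
  have "norm (u n) \<le> K ^ n" for n
  proof (induction n rule: less_induct)
    case (less n)
    show ?case
    proof (cases n)
      case 0
      then show ?thesis using assms by (simp add: sporadic_recurrence_def)
    next
      case (Suc m)
      have "norm (u (m - 1)) \<le> K ^ (m - 1)" using less Suc by simp
      also have "\<dots> \<le> K ^ m" using K by (intro power_increasing) auto
      finally have "norm (u n) \<le> K1 * K ^ m + K2 * K ^ m"
        using step[of m] less[of m] Suc K
        by (smt (verit) Suc_eq_plus1 lessI mult_left_mono)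
      also have "\<dots> \<le> K * K ^ m"
        using K unfolding distrib_right[symmetric] by (intro mult_right_mono) (auto simp: K_def)
      finally show ?thesis using Suc by simp
    qed
  qed
  then show ?thesis using K(3) by (intro exI[of _ K]) auto
qed

lemma sporadic_conv_radius_pos:
  assumes "sporadic_recurrence A B C E u"
  shows "fps_conv_radius (Abs_fps u) > 0"
proof -
  obtain K where K: "K > 0" "\<And>n. norm (u n) \<le> K ^ n"
    using recurrence_imp_geometric_bound[OF assms] by blast
  have "summable (\<lambda>n. u n * (of_real (1 / (2 * K)))^n)"
  proof (rule summable_comparison_test')
    show "summable (\<lambda>n. (1/2::real)^n)" by (simp add: summable_geometric)
    fix n :: nat
    have "norm (u n * (of_real (1 / (2 * K)))^n) \<le> K^n * (1 / (2 * K))^n"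
      using K by (simp add: norm_mult norm_power norm_divide mult_right_mono divide_right_mono)
    also have "\<dots> = (1/2)^n" using K by (simp add: power_mult_distrib[symmetric])
    finally show "norm (u n * (of_real (1 / (2 * K)))^n) \<le> (1/2)^n" .
  qed
  from conv_radius_geI[OF this] have "conv_radius u \<ge> ereal (norm (of_real (1 / (2 * K)) :: complex))" .
  moreover have "norm (of_real (1 / (2 * K)) :: complex) > 0" using K by simp
  ultimately have "conv_radius u > 0"
    by (metis ereal_less(2) less_le_trans)
  then show ?thesis by (simp add: fps_conv_radius_def)
qed

section \<open>The six coefficient sequences\<close>

lemma fact_triple:
  "fact (3 * Suc n) = (3 * of_nat n + 3) * (3 * of_nat n + 2) * (3 * of_nat n + 1) * (fact (3 * n) :: complex)"
  by (simp add: eval_nat_numeral algebra_simps)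

lemma fact_quadruple: "fact (4 * Suc n) =
   (4 * of_nat n + 4) * (4 * of_nat n + 3) * (4 * of_nat n + 2) * (4 * of_nat n + 1) * (fact (4 * n) :: complex)"
  by (simp add: eval_nat_numeral algebra_simps)

lemma fact_sextuple: "fact (6 * Suc n) = (6 * of_nat n + 6) * (6 * of_nat n + 5) * (6 * of_nat n + 4)
     * (6 * of_nat n + 3) * (6 * of_nat n + 2) * (6 * of_nat n + 1) * (fact (6 * n) :: complex)"
proof -
  have "fact (6 * Suc n) = (fact (Suc (Suc (Suc (Suc (Suc (Suc (6 * n))))))) :: complex)"
    by (simp add: eval_nat_numeral)
  show ?thesis
    by (subst \<open>fact (6 * Suc n) = _\<close>, simp only: fact_Suc of_nat_Suc of_nat_mult of_nat_numeral) algebra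
qed

lemma F1_coefficient_recurrence:
  "sporadic_recurrence 864 120 0 0
     (\<lambda>n. of_nat (((6 * n) choose (3 * n)) * ((3 * n) choose (2 * n)) * ((2 * n) choose n)))"
    (is "sporadic_recurrence _ _ _ _ ?u")
  unfolding sporadic_recurrence_def
proof (intro conjI allI)
  have u: "?u n = fact (6 * n) / (fact (3 * n) * fact n ^ 3)" for n
    by (simp add: binomial_fact power3_eq_cube)
  fix n
  define N where "N = (of_nat n :: complex)"
  have f: "fact (6 * (n + 1)) = (6 * N + 6) * (6 * N + 5) * (6 * N + 4)
      * (6 * N + 3) * (6 * N + 2) * (6 * N + 1) * (fact (6 * n) :: complex)"
    "fact (3 * (n + 1)) = (3 * N + 3) * (3 * N + 2) * (3 * N + 1) * (fact (3 * n) :: complex)"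
    "fact (n + 1) = (N + 1) * (fact n :: complex)"
    using fact_sextuple[of n] fact_triple[of n] by (simp_all add: N_def add_ac)
  have nz: "fact (3 * (n + 1)) \<noteq> (0::complex)" "fact (n + 1) \<noteq> (0::complex)" "fact (3 * n) \<noteq> (0::complex)"
    "fact n \<noteq> (0::complex)" by (rule fact_nonzero)+
  then show "(of_nat n + 1)^3 * ?u (n + 1) =
        (2 * of_nat n + 1) * (864 * of_nat n^2 + 864 * of_nat n + 120) * ?u n
        + of_nat n * (0 * of_nat n^2 + 0) * ?u (n - 1)"
    unfolding u N_def[symmetric] unfolding f by (simp add: divide_simps) algebra
qed simp

lemma F2_coefficient_recurrence:
  "sporadic_recurrence 128 24 0 0 (\<lambda>n. of_nat (((4 * n) choose (2 * n)) * ((2 * n) choose n) ^ 2))"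
    (is "sporadic_recurrence _ _ _ _ ?u")
  unfolding sporadic_recurrence_def
proof (intro conjI allI)
  have u: "?u n = fact (4 * n) / fact n ^ 4" for n
    by (simp add: binomial_fact power2_eq_square power4_eq_xxxx)
  fix n
  define N where "N = (of_nat n :: complex)"
  have f: "fact (4 * (n + 1)) = (4 * N + 4) * (4 * N + 3) * (4 * N + 2) * (4 * N + 1) * (fact (4 * n) :: complex)"
    "fact (n + 1) = (N + 1) * (fact n :: complex)"
    using fact_quadruple[of n] by (simp_all add: N_def add_ac)
  have nz: "fact (n + 1) \<noteq> (0::complex)" "fact n \<noteq> (0::complex)" by (rule fact_nonzero)+
  then show "(of_nat n + 1)^3 * ?u (n + 1) =
        (2 * of_nat n + 1) * (128 * of_nat n^2 + 128 * of_nat n + 24) * ?u n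
        + of_nat n * (0 * of_nat n^2 + 0) * ?u (n - 1)"
    unfolding u N_def[symmetric] unfolding f by (simp add: divide_simps) algebra
qed simp

lemma central_binomial_Suc:
  "(of_nat n + 1) * of_nat ((2 * (n + 1)) choose (n + 1)) = 2 * (2 * of_nat n + 1) * (of_nat ((2 * n) choose n) :: complex)"
proof -
  define N where "N = (of_nat n :: complex)"
  have f: "fact (2 * (n + 1)) = (2 * N + 2) * (2 * N + 1) * (fact (2 * n) :: complex)"
    "fact (n + 1) = (N + 1) * (fact n :: complex)"
    by (simp_all add: N_def algebra_simps)
  have u: "of_nat ((2 * n) choose n) = (fact (2 * n) / fact n ^ 2 :: complex)" for n
    by (simp add: binomial_fact power2_eq_square)
  have nz: "fact (n + 1) \<noteq> (0::complex)" "fact n \<noteq> (0::complex)" by (rule fact_nonzero)+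
  then show ?thesis
    unfolding u N_def[symmetric] unfolding f by (simp add: divide_simps) algebra
qed

lemma F4_coefficient_recurrence:
  "sporadic_recurrence 32 8 0 0 (\<lambda>n. of_nat (((2 * n) choose n) ^ 3))"
  unfolding sporadic_recurrence_def
proof (intro conjI allI)
  fix n
  show "(of_nat n + 1)^3 * of_nat (((2 * (n + 1)) choose (n + 1)) ^ 3) =
        (2 * of_nat n + 1) * (32 * of_nat n^2 + 32 * of_nat n + 8) * (of_nat (((2 * n) choose n) ^ 3) :: complex)
        + of_nat n * (0 * of_nat n^2 + 0) * of_nat (((2 * (n - 1)) choose (n - 1)) ^ 3)"
    unfolding of_nat_power using central_binomial_Suc[of n] by algebra
qed simp

lemma F5_coefficient_recurrence:
  "sporadic_recurrence 22 6 16 (- 4) (\<lambda>n. of_nat ((2 * n) choose n) * seq_t 11 3 1 n)"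
  unfolding sporadic_recurrence_def
proof (intro conjI allI)
  fix n
  define c where "c n = (of_nat ((2 * n) choose n) :: complex)" for n
  define N where "N = (of_nat n :: complex)"
  define t where "t = seq_t 11 3 1"
  have "N * c n = 2 * (2 * N - 1) * c (n - 1)" if "n > 0"
    using central_binomial_Suc[of "n - 1"] that by (simp add: c_def N_def algebra_simps of_nat_diff)
  then have "N^2 * c n = 2 * (2 * N - 1) * N * c (n - 1)"
    by (cases "n = 0") (auto simp: N_def power2_eq_square)
  moreover have "(N + 1) * c (n + 1) = 2 * (2 * N + 1) * c n"
    using central_binomial_Suc[of n] by (simp add: c_def N_def)
  moreover have "(N + 1)^2 * t (n + 1) = (11 * N^2 + 11 * N + 3) * t n + N^2 * t (n - 1)"
    using seq_t_recurrence[of n 11 3 1] by (simp add: t_def N_def)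
  ultimately show "(of_nat n + 1)^3 * (of_nat ((2 * (n + 1)) choose (n + 1)) * seq_t 11 3 1 (n + 1)) =
        (2 * of_nat n + 1) * (22 * of_nat n^2 + 22 * of_nat n + 6) * (of_nat ((2 * n) choose n) * seq_t 11 3 1 n)
        + of_nat n * (16 * of_nat n^2 + - 4) * (of_nat ((2 * (n - 1)) choose (n - 1)) * seq_t 11 3 1 (n - 1))"
    unfolding c_def[symmetric] N_def[symmetric] t_def[symmetric] by algebra
qed simp

lemma G5_coefficient_recurrence: "sporadic_recurrence (- 11) (- 5) (- 125) 0 (seq_T 11 3 1)"
  unfolding sporadic_recurrence_def
proof (intro conjI allI)
  fix n
  show "(of_nat n + 1)^3 * seq_T 11 3 1 (n + 1) =
        (2 * of_nat n + 1) * (- 11 * of_nat n^2 + - 11 * of_nat n + - 5) * seq_T 11 3 1 n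
        + of_nat n * (- 125 * of_nat n^2 + 0) * seq_T 11 3 1 (n - 1)"
    using seq_T_recurrence[of n 11 3 1] by algebra
qed simp

text \<open>
  Creative telescoping for the fourth powers. Divided by the fourth power of \<open>(n + 1) choose j\<close>, the
  recurrence for the summands and the difference of a rational multiple of the summand are
  polynomials in \<open>n\<close> and \<open>j\<close>. The ansatz of degree five in \<open>j\<close> for the certificate \<open>K\<close> gives a linear
  system over the rational functions in \<open>n\<close>, whose solution, cleared of its denominator \<open>n^3\<close>, is used
  here.
\<close>
lemma fourth_power_binomial_certificate:
  fixes n j :: complex
  defines "K \<equiv> \<lambda>j. (- 10 * n - 80 * n^2 - 255 * n^3 - 385 * n^4 - 275 * n^5 - 75 * n^6)
     + (4 + 72 * n + 368 * n^2 + 796 * n^3 + 756 * n^4 + 260 * n^5) * j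
     - (16 + 172 * n + 600 * n^2 + 818 * n^3 + 374 * n^4) * j^2
     + (24 + 184 * n + 416 * n^2 + 276 * n^3) * j^3 - (16 + 90 * n + 104 * n^2) * j^4 + (4 + 16 * n) * j^5"
  shows "(n + 1)^7 * n^3 - (2 * n + 1) * (6 * n^2 + 6 * n + 2) * n^3 * (n + 1 - j)^4
          - (64 * n^2 - 4) * ((n + 1 - j) * (n - j))^4
       = (n + 1 - j)^4 * K (j + 1) - j^4 * K j"
  unfolding K_def by algebra

lemma sum_binomial_fourth_recurrence:
  fixes n :: nat
  defines "f \<equiv> \<lambda>n. (of_nat (\<Sum>j = 0..n. (n choose j) ^ 4) :: complex)"
  shows "(of_nat n + 1)^3 * f (n + 1) = (2 * of_nat n + 1) * (6 * of_nat n^2 + 6 * of_nat n + 2) * f n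
        + of_nat n * (64 * of_nat n^2 - 4) * f (n - 1)"
proof (cases "n = 0")
  case True
  then show ?thesis by (simp add: f_def)
next
  case False
  define N where "N = (of_nat n :: complex)"
  have N: "N \<noteq> 0" "N + 1 \<noteq> 0"
    using False of_nat_neq_0[of n, where ?'a = complex] by (simp_all add: N_def add.commute)
  define K where "K = (\<lambda>j. (- 10 * N - 80 * N^2 - 255 * N^3 - 385 * N^4 - 275 * N^5 - 75 * N^6)
     + (4 + 72 * N + 368 * N^2 + 796 * N^3 + 756 * N^4 + 260 * N^5) * j
     - (16 + 172 * N + 600 * N^2 + 818 * N^3 + 374 * N^4) * j^2
     + (24 + 184 * N + 416 * N^2 + 276 * N^3) * j^3 - (16 + 90 * N + 104 * N^2) * j^4 + (4 + 16 * N) * j^5)"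
  define B where "B m j = (of_nat (m choose j) :: complex)" for m j
  \<comment> \<open>One common range of summation, padded with zero terms.\<close>
  have f: "f m = (\<Sum>j<n + 2. B m j ^ 4)" if "m \<le> n + 1" for m
    unfolding f_def B_def of_nat_sum of_nat_power
    by (rule sum.mono_neutral_left) (use that in \<open>auto simp: binomial_eq_0\<close>)
  have down: "(of_nat m + 1) * B m j = (of_nat m + 1 - of_nat j) * B (m + 1) j" for m j
  proof (cases "j \<le> m + 1")
    case True
    have "(m + 1 - j) * ((m + 1) choose j) = (m + 1) * (m choose j)"
      using binomial_absorb_comp[of "m + 1" j] by simp
    then have "of_nat (m + 1 - j) * B (m + 1) j = (of_nat m + 1) * B m j"
      unfolding B_def by (metis of_nat_mult of_nat_add of_nat_1)
    moreover have "of_nat (m + 1 - j) = (of_nat m + 1 - of_nat j :: complex)"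
      using True by (simp add: of_nat_diff)
    ultimately show ?thesis by simp
  qed (simp add: B_def binomial_eq_0)
  \<comment> \<open>The telescoping quantity; the factor \<open>j^4\<close> kills it at \<open>j = 0\<close>, the binomial at \<open>j = n + 2\<close>.\<close>
  define G where "G j = B (n + 1) j ^ 4 * of_nat j ^ 4 * K (of_nat j)" for j
  have step: "(N + 1)^4 * N^3 * ((N + 1)^3 * B (n + 1) j ^ 4
        - (2 * N + 1) * (6 * N^2 + 6 * N + 2) * B n j ^ 4 - N * (64 * N^2 - 4) * B (n - 1) j ^ 4)
      = G (j + 1) - G j" for j
  proof -
    define J b where "J = (of_nat j :: complex)" and "b = B (n + 1) j"
    have B1: "(N + 1) * B n j = (N + 1 - J) * b"
      using down[of n j] by (simp add: N_def J_def b_def)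
    have "N * B (n - 1) j = (N - J) * B n j"
      using down[of "n - 1" j] False by (simp add: N_def J_def of_nat_diff)
    then have B2: "(N + 1) * N * B (n - 1) j = (N + 1 - J) * (N - J) * b"
      using B1 by algebra
    have "(j + 1) * ((n + 1) choose (j + 1)) = (n + 1 - j) * ((n + 1) choose j)"
      using binomial_absorption[of j "n + 1"] binomial_absorb_comp[of "n + 1" j] by simp
    then have "(J + 1) * B (n + 1) (j + 1) = of_nat (n + 1 - j) * b"
      unfolding B_def J_def b_def by (metis of_nat_mult of_nat_add of_nat_1)
    then have B3: "(J + 1) * B (n + 1) (j + 1) = (N + 1 - J) * b"
      by (cases "j \<le> n + 1") (simp_all add: J_def N_def b_def B_def of_nat_diff binomial_eq_0)
    have G1: "G (j + 1) = ((N + 1 - J) * b)^4 * K (J + 1)"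
      unfolding B3[symmetric] by (simp add: G_def J_def power_mult_distrib mult_ac add_ac)
    have "(N + 1)^4 * N^3 * ((N + 1)^3 * b ^ 4
        - (2 * N + 1) * (6 * N^2 + 6 * N + 2) * B n j ^ 4 - N * (64 * N^2 - 4) * B (n - 1) j ^ 4)
      = (N + 1)^7 * N^3 * b^4 - (2 * N + 1) * (6 * N^2 + 6 * N + 2) * N^3 * ((N + 1) * B n j)^4
        - (64 * N^2 - 4) * ((N + 1) * N * B (n - 1) j)^4"
      by algebra
    also have "\<dots> = b^4 * ((N + 1)^7 * N^3 - (2 * N + 1) * (6 * N^2 + 6 * N + 2) * N^3 * (N + 1 - J)^4
          - (64 * N^2 - 4) * ((N + 1 - J) * (N - J))^4)"
      unfolding B1 B2 by algebra
    also have "\<dots> = b^4 * ((N + 1 - J)^4 * K (J + 1) - J^4 * K J)"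
      using fourth_power_binomial_certificate[of N J] by (simp add: K_def)
    also have "\<dots> = G (j + 1) - G j"
      unfolding G1 unfolding G_def b_def[symmetric] J_def[symmetric] by algebra
    finally show ?thesis unfolding b_def .
  qed
  have "(N + 1)^4 * N^3 * ((N + 1)^3 * f (n + 1)
        - (2 * N + 1) * (6 * N^2 + 6 * N + 2) * f n - N * (64 * N^2 - 4) * f (n - 1))
      = (\<Sum>j<n + 2. (N + 1)^4 * N^3 * ((N + 1)^3 * B (n + 1) j ^ 4
        - (2 * N + 1) * (6 * N^2 + 6 * N + 2) * B n j ^ 4 - N * (64 * N^2 - 4) * B (n - 1) j ^ 4))"
  proof -
    have "f (n + 1) = (\<Sum>j<n + 2. B (n + 1) j ^ 4)" "f n = (\<Sum>j<n + 2. B n j ^ 4)"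
      "f (n - 1) = (\<Sum>j<n + 2. B (n - 1) j ^ 4)" by (rule f, simp)+
    then show ?thesis
      by (simp only: sum_distrib_left sum_subtractf right_diff_distrib)
  qed
  also have "\<dots> = (\<Sum>j<n + 2. G (j + 1) - G j)"
    by (simp only: step)
  also have "\<dots> = G (n + 2) - G 0"
    using sum_lessThan_telescope[of G "n + 2"] by simp
  also have "\<dots> = 0"
    by (simp add: G_def B_def binomial_eq_0)
  finally have "(N + 1)^3 * f (n + 1) - (2 * N + 1) * (6 * N^2 + 6 * N + 2) * f n
      - N * (64 * N^2 - 4) * f (n - 1) = 0"
    using N by (metis mult_eq_0_iff power_not_zero)
  then show ?thesis unfolding N_def[symmetric] by algebra
qed

lemma H_coefficient_recurrence:
  "sporadic_recurrence 6 2 64 (- 4) (\<lambda>n. of_nat (\<Sum>j = 0..n. (n choose j) ^ 4))"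
  unfolding sporadic_recurrence_def using sum_binomial_fourth_recurrence by simp

section \<open>Rational substitutions\<close>

text \<open>
  For a rational substitution \<open>X = N / M\<close> and the equations of the recurrence the hypotheses of the
  pullback become identities between polynomials. The number \<open>e\<close> is the order of \<open>X\<close> at 0, which
  forces the constant \<open>e^2\<close>.
\<close>
lemma rational_pullback:
  fixes A B C E :: int and e :: nat and M N X a b g R S Q :: "complex fps"
  assumes u: "sporadic_recurrence (of_int A) (of_int B) (of_int C) (of_int E) u"
    and XM: "X * M = N" and X0: "fps_nth X 0 = 0" and M0: "fps_nth M 0 \<noteq> 0"
    and g0: "fps_nth g 0 \<noteq> 0" and R0: "fps_nth R 0 \<noteq> 0"
    and b0: "fps_nth b 0 \<noteq> 0" and ab: "a^2 * b = 1"
    and X: "g * (\<theta> N * M - N * \<theta> M) = R * N * M"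
    and S: "S * R^2 * M^2 = of_nat e ^ 2 * (M^2 - of_int (2 * A) * N * M - of_int C * N^2) * b * g^2"
    and Q: "4 * Q * b^2 * M^2 = 4 * of_nat e ^ 2 * (of_int (2 * B) * N * M + of_int (C + E) * N^2) * b^3
              + M^2 * (5 * S * (\<theta> b)^2 - 4 * S * b * \<theta> (\<theta> b) - 2 * \<theta> S * b * \<theta> b)"
  shows "first_integral_ode S Q (a * (Abs_fps u oo X))"
proof (rule first_integral_ode_pullback)
  let ?s = "1 - fps_const (2 * of_int A) * fps_X - fps_const (of_int C) * fps_X^2 :: complex fps"
  let ?q = "fps_const (2 * of_int B) * fps_X + fps_const (of_int C + of_int E) * fps_X^2 :: complex fps"
  show "first_integral_ode ?s ?q (Abs_fps u)"
    by (rule recurrence_imp_first_integral_ode[OF u])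
  have M: "M \<noteq> 0" using M0 by auto
  have "g * (M^2 * \<theta> X) = M^2 * (R * X)"
  proof -
    have "\<theta> N = \<theta> X * M + X * \<theta> M" by (simp add: XM[symmetric] euler_simps)
    then show ?thesis using X unfolding XM[symmetric] by algebra
  qed
  then show "g * \<theta> X = R * X" using M by (simp add: mult.left_commute)
  have const: "fps_const (2 * of_int K) = of_int (2 * K)" "fps_const (of_int K) = of_int K"
    "fps_const (of_int K + of_int K') = of_int (K + K')"
    for K K' :: int by (simp_all flip: fps_of_int)
  have X2: "fps_X^2 oo X = X^2"
    by (simp add: power2_eq_square fps_compose_mult_distrib[OF X0] X0)
  have s: "?s oo X = 1 - of_int (2 * A) * X - of_int C * X^2"
    by (simp add: fps_compose_sub_distrib fps_compose_mult_distrib[OF X0] X2 X0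
          del: of_int_mult) (simp add: const del: of_int_mult)
  have q: "?q oo X = of_int (2 * B) * X + of_int (C + E) * X^2"
    by (simp add: fps_compose_add_distrib fps_compose_mult_distrib[OF X0] X2 X0
          del: of_int_mult of_int_add) (simp add: const del: of_int_mult of_int_add)
  have "M^2 * (S * R^2) = M^2 * (of_nat e ^ 2 * (?s oo X) * b * g^2)"
    using S unfolding s XM[symmetric] by algebra
  then show "S * R^2 = of_nat e ^ 2 * (?s oo X) * b * g^2" using M by simp
  have "M^2 * (4 * Q * b^2) = M^2 * (4 * of_nat e ^ 2 * (?q oo X) * b^3 - 4 * S * b * \<theta> (\<theta> b)
              + 5 * S * (\<theta> b)^2 - 2 * \<theta> S * b * \<theta> b)"
    using Q unfolding q XM[symmetric] by algebra
  then show "4 * Q * b^2 = 4 * of_nat e ^ 2 * (?q oo X) * b^3 - 4 * S * b * \<theta> (\<theta> b)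
              + 5 * S * (\<theta> b)^2 - 2 * \<theta> S * b * \<theta> b" using M by simp
  show "\<theta> (of_nat e ^ 2) = (0 :: complex fps)" by (simp add: euler_numeral flip: fps_of_nat)
qed fact+

text \<open>
  The equation common to the thirteen functions. It can be found from any one of them by solving the
  hypotheses of the pullback for \<open>S\<close> and \<open>Q\<close>.
\<close>
definition common_S :: "complex fps" where
  "common_S = ((1 + fps_X) * (1 - 4 * fps_X))^2 * (1 + 4 * fps_X^2)"
definition common_Q :: "complex fps" where
  "common_Q = 4 * (fps_X - 15 * fps_X^4 - 160 * fps_X^5 - 144 * fps_X^6)"

definition common_germ :: "(complex \<Rightarrow> complex) \<Rightarrow> bool" where
  "common_germ f \<longleftrightarrow> (\<exists>z. f has_fps_expansion z \<and> first_integral_ode common_S common_Q z \<and> fps_nth z 0 = 1)"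

lemma common_germ_unique:
  assumes "common_germ f" "common_germ h"
  shows "\<forall>\<^sub>F p in nhds 0. f p = h p"
proof -
  obtain y z where y: "f has_fps_expansion y" "first_integral_ode common_S common_Q y" "fps_nth y 0 = 1"
    and z: "h has_fps_expansion z" "first_integral_ode common_S common_Q z" "fps_nth z 0 = 1"
    using assms by (auto simp: common_germ_def)
  have "y = z"
    by (rule first_integral_ode_unique[OF y(2) z(2)]) (simp_all add: common_S_def common_Q_def y z fps_power_zeroth numeral_fps_const)
  then have "(\<lambda>p. f p - h p) has_fps_expansion 0"
    using has_fps_expansion_diff[OF y(1) z(1)] by simp
  then show ?thesis by (simp add: has_fps_expansion_0_iff)
qed

text \<open>
  The fractional power enters only through \<open>\<kappa>\<close>, and only its analyticity, its value at 0, and its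
  square \<open>\<beta>\<close> matter; this is where the choice of branch is used.
\<close>
lemma common_germI:
  fixes A B C E :: int and e :: nat and M N b g R :: "complex fps"
  assumes u: "sporadic_recurrence (of_int A) (of_int B) (of_int C) (of_int E) u"
    and F: "\<And>x. F x = (\<Sum>n. u n * x ^ n)"
    and exps: "m has_fps_expansion M" "n has_fps_expansion N" "\<beta> has_fps_expansion b"
    and \<kappa>: "\<kappa> analytic_on {0}" "\<kappa> 0 = 1" "\<And>p. \<kappa> p ^ 2 = \<beta> p"
    and nz: "fps_nth N 0 = 0" "fps_nth M 0 \<noteq> 0" "fps_nth g 0 \<noteq> 0" "fps_nth R 0 \<noteq> 0"
    and X: "g * (\<theta> N * M - N * \<theta> M) = R * N * M"
    and S: "common_S * R^2 * M^2 = of_nat e ^ 2 * (M^2 - of_int (2 * A) * N * M - of_int C * N^2) * b * g^2"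
    and Q: "4 * common_Q * b^2 * M^2 = 4 * of_nat e ^ 2 * (of_int (2 * B) * N * M + of_int (C + E) * N^2) * b^3
              + M^2 * (5 * common_S * (\<theta> b)^2 - 4 * common_S * b * \<theta> (\<theta> b) - 2 * \<theta> common_S * b * \<theta> b)"
  shows "common_germ (\<lambda>p. 1 / \<kappa> p * F (n p / m p))"
proof -
  define a X where "a = inverse (fps_expansion \<kappa> 0)" and "X = N * inverse M"
  have k: "\<kappa> has_fps_expansion fps_expansion \<kappa> 0"
    using \<kappa> by (simp add: analytic_at_imp_has_fps_expansion_0)
  have k0: "fps_nth (fps_expansion \<kappa> 0) 0 = 1"
    using has_fps_expansion_imp_0_eq_fps_nth_0[OF k] \<kappa>(2) by simp
  have a: "(\<lambda>p. 1 / \<kappa> p) has_fps_expansion a"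
    using has_fps_expansion_inverse[OF k] k0 by (simp add: a_def field_simps)
  have x: "(\<lambda>p. n p / m p) has_fps_expansion X"
    using has_fps_expansion_mult[OF exps(2) has_fps_expansion_inverse[OF exps(1) nz(2)]]
    by (simp add: X_def field_simps)
  have X0: "fps_nth X 0 = 0" by (simp add: X_def nz)
  have XM: "X * M = N" by (simp add: X_def mult.assoc inverse_mult_eq_1[OF nz(2)])
  have b: "b = fps_expansion \<kappa> 0 ^ 2"
  proof (rule fps_expansion_unique_complex[OF exps(3)])
    show "\<beta> has_fps_expansion fps_expansion \<kappa> 0 ^ 2"
      using has_fps_expansion_mult[OF k k] \<kappa>(3) by (simp add: power2_eq_square)
  qed
  have ab: "a^2 * b = 1"
    by (simp add: a_def b inverse_mult_eq_1 k0 flip: power_mult_distrib)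
  have b0: "fps_nth b 0 \<noteq> 0" by (simp add: b k0 fps_power_zeroth)
  have "F has_fps_expansion Abs_fps u"
    using eval_fps_has_fps_expansion[OF sporadic_conv_radius_pos[OF u]]
    by (simp add: eval_fps_def[abs_def] F[abs_def])
  then have "(\<lambda>p. 1 / \<kappa> p * F (n p / m p)) has_fps_expansion a * (Abs_fps u oo X)"
    using has_fps_expansion_mult[OF a has_fps_expansion_compose[OF _ x X0]] by (simp add: o_def)
  moreover have "first_integral_ode common_S common_Q (a * (Abs_fps u oo X))"
    by (rule rational_pullback[OF u XM X0 nz(2-4) b0 ab X S Q])
  moreover have "fps_nth (a * (Abs_fps u oo X)) 0 = 1"
    using u by (simp add: a_def k0 sporadic_recurrence_def)
  ultimately show ?thesis unfolding common_germ_def by blast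
qed

lemma powr_half_multiple_squared:
  fixes z :: complex
  shows "(z powr (1/2))^2 = z" "(z powr (3/2))^2 = z^3" "(z powr (5/2))^2 = z^5"
  by (cases "z = 0"; simp add: power2_eq_square flip: powr_add; use powr_nat[of z] in force)+

section \<open>The thirteen functions\<close>

lemmas of_int_eval = of_int_numeral of_int_neg_numeral of_int_0 of_int_1 of_int_mult of_int_add of_int_minus

lemmas F1_germI = common_germI[where A = 864 and B = 120 and C = 0 and E = 0, unfolded of_int_eval,
  OF F1_coefficient_recurrence F1_def]
lemmas F2_germI = common_germI[where A = 128 and B = 24 and C = 0 and E = 0, unfolded of_int_eval,
  OF F2_coefficient_recurrence F2_def]
lemmas F4_germI = common_germI[where A = 32 and B = 8 and C = 0 and E = 0, unfolded of_int_eval,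
  OF F4_coefficient_recurrence F4_def]
lemmas F5_germI = common_germI[where A = 22 and B = 6 and C = 16 and E = "- 4", unfolded of_int_eval,
  OF F5_coefficient_recurrence F5_def]
lemmas G5_germI = common_germI[where A = "- 11" and B = "- 5" and C = "- 125" and E = 0, unfolded of_int_eval,
  OF G5_coefficient_recurrence G5_def]
lemmas H_germI = common_germI[where A = 6 and B = 2 and C = 64 and E = "- 4", unfolded of_int_eval,
  OF H_coefficient_recurrence H_def]

text \<open>
  Let \<open>e\<close> be the index of one of the next four polynomials. In the modular
  parametrization, where \<open>p\<close> has level 10 and \<open>Z\<close> is the common
  function of weight two, \<open>eisenstein_e(p) Z^2\<close> is the Eisenstein series of weight four at the
  \<open>e\<close>-th power of the nome. Polymorphism allows both numbers and \<open>fps_X\<close> as arguments.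
\<close>
definition eisenstein_1 :: "'a::comm_ring_1 \<Rightarrow> 'a" where
  "eisenstein_1 p = 1 + 236*p + 1440*p^2 + 1920*p^3 + 3840*p^4 + 256*p^5 + 256*p^6"

definition eisenstein_2 :: "'a::comm_ring_1 \<Rightarrow> 'a" where
  "eisenstein_2 p = 1 - 4*p + 240*p^2 - 480*p^3 + 1440*p^4 - 944*p^5 + 16*p^6"

definition eisenstein_5 :: "'a::comm_ring_1 \<Rightarrow> 'a" where
  "eisenstein_5 p = 1 - 4*p + 256*p^5 + 256*p^6"

definition eisenstein_10 :: "'a::comm_ring_1 \<Rightarrow> 'a" where
  "eisenstein_10 p = 1 - 4*p + 16*p^5 + 16*p^6"

text \<open>
  In each of the following lemmas \<open>R / g\<close> is the logarithmic derivative \<open>\<theta> x / x\<close> of the argument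
  \<open>x\<close>: the factors of \<open>x\<close> give the denominator \<open>g\<close>, and \<open>R\<close> is then found by polynomial division.
  The index in the name of a lemma is the order of \<open>x\<close> at 0.
\<close>
lemma F1_germ_1:
  "common_germ (\<lambda>p. 1 / eisenstein_1 p powr (1/2)
    * F1 (p * (1 - 4*p)^10 * (1 + p)^5 / eisenstein_1 p ^ 3))"
proof -
  define p :: "complex fps" where "p = fps_X"
  show ?thesis
  proof (rule F1_germI[where e = 1 and \<beta> = "\<lambda>p. eisenstein_1 p" and b = "eisenstein_1 p"
      and M = "eisenstein_1 p ^ 3" and N = "p * (1 - 4*p)^10 * (1 + p)^5"
      and g = "(1 + p) * (1 - 4*p) * eisenstein_1 p"
      and R = "1 - 510*p - 14108*p^2 - 56432*p^3 - 120960*p^4 - 65024*p^5 - 64000*p^6 + 3072*p^7 + 2048*p^8"])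
  qed (unfold eisenstein_1_def p_def common_S_def common_Q_def,
       (intro fps_expansion_intros; fail)+,
       force intro!: analytic_intros,
       simp,
       simp add: powr_half_multiple_squared power_mult_distrib flip: power_mult,
       (simp add: numeral_fps_const fps_power_zeroth; fail)+,
       (simp only: euler_eval of_nat_numeral of_nat_1 power_one, algebra)+)
qed

lemma F1_germ_2:
  "common_germ (\<lambda>p. 1 / eisenstein_2 p powr (1/2)
    * F1 (p^2 * (1 - 4*p)^5 * (1 + p)^10 / eisenstein_2 p ^ 3))"
proof -
  define p :: "complex fps" where "p = fps_X"
  show ?thesis
  proof (rule F1_germI[where e = 2 and \<beta> = "\<lambda>p. eisenstein_2 p" and b = "eisenstein_2 p"
      and M = "eisenstein_2 p ^ 3" and N = "p^2 * (1 - 4*p)^5 * (1 + p)^10"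
      and g = "(1 + p) * (1 - 4*p) * eisenstein_2 p"
      and R = "2 - 12*p - 1000*p^2 + 4064*p^3 - 30240*p^4 + 56432*p^5 - 56432*p^6 + 8160*p^7 + 64*p^8"])
  qed (unfold eisenstein_2_def p_def common_S_def common_Q_def,
       (intro fps_expansion_intros; fail)+,
       force intro!: analytic_intros,
       simp,
       simp add: powr_half_multiple_squared power_mult_distrib flip: power_mult,
       (simp add: numeral_fps_const fps_power_zeroth; fail)+,
       (simp only: euler_eval of_nat_numeral of_nat_1 power_one, algebra)+)
qed

lemma F1_germ_5:
  "common_germ (\<lambda>p. 1 / eisenstein_5 p powr (1/2)
    * F1 (p^5 * (1 - 4*p)^2 * (1 + p) / eisenstein_5 p ^ 3))"
proof -
  define p :: "complex fps" where "p = fps_X"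
  show ?thesis
  proof (rule F1_germI[where e = 5 and \<beta> = "\<lambda>p. eisenstein_5 p" and b = "eisenstein_5 p"
      and M = "eisenstein_5 p ^ 3" and N = "p^5 * (1 - 4*p)^2 * (1 + p)"
      and g = "(1 + p) * (1 - 4*p) * eisenstein_5 p"
      and R = "5 - 30*p + 20*p^2 + 80*p^3 - 2560*p^5 + 2560*p^6 + 15360*p^7 + 10240*p^8"])
  qed (unfold eisenstein_5_def p_def common_S_def common_Q_def,
       (intro fps_expansion_intros; fail)+,
       force intro!: analytic_intros,
       simp,
       simp add: powr_half_multiple_squared power_mult_distrib flip: power_mult,
       (simp add: numeral_fps_const fps_power_zeroth; fail)+,
       (simp only: euler_eval of_nat_numeral of_nat_1 power_one, algebra)+)
qed

lemma F1_germ_10: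
  "common_germ (\<lambda>p. 1 / eisenstein_10 p powr (1/2)
    * F1 (p^10 * (1 - 4*p) * (1 + p)^2 / eisenstein_10 p ^ 3))"
proof -
  define p :: "complex fps" where "p = fps_X"
  show ?thesis
  proof (rule F1_germI[where e = 10 and \<beta> = "\<lambda>p. eisenstein_10 p" and b = "eisenstein_10 p"
      and M = "eisenstein_10 p ^ 3" and N = "p^10 * (1 - 4*p) * (1 + p)^2"
      and g = "(1 + p) * (1 - 4*p) * eisenstein_10 p"
      and R = "10 - 60*p + 40*p^2 + 160*p^3 - 80*p^5 + 80*p^6 + 480*p^7 + 320*p^8"])
  qed (unfold eisenstein_10_def p_def common_S_def common_Q_def,
       (intro fps_expansion_intros; fail)+,
       force intro!: analytic_intros,
       simp,
       simp add: powr_half_multiple_squared power_mult_distrib flip: power_mult,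
       (simp add: numeral_fps_const fps_power_zeroth; fail)+,
       (simp only: euler_eval of_nat_numeral of_nat_1 power_one, algebra)+)
qed

lemma F2_germ_1:
  "common_germ (\<lambda>p. 1 / ((1 + 4*p^2) powr (1/2) * (1 + 22*p - 4*p^2))
    * F2 (p * (1 + p)^5 * (1 - 4*p)^5 / ((1 + 4*p^2)^2 * (1 + 22*p - 4*p^2)^4)))"
proof -
  define p :: "complex fps" where "p = fps_X"
  show ?thesis
  proof (rule F2_germI[where e = 1 and \<beta> = "\<lambda>p. (1 + 4*p^2) * (1 + 22*p - 4*p^2)^2" and b = "(1 + 4*p^2) * (1 + 22*p - 4*p^2)^2"
      and M = "((1 + 4*p^2)^2 * (1 + 22*p - 4*p^2)^4)" and N = "p * (1 + p)^5 * (1 - 4*p)^5"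
      and g = "(1 + p) * (1 - 4*p) * (1 + 4*p^2) * (1 + 22*p - 4*p^2)"
      and R = "1 - 84*p - 160*p^2 - 1280*p^3 + 640*p^4 - 1344*p^5 - 64*p^6"])
  qed (unfold p_def common_S_def common_Q_def,
       (intro fps_expansion_intros; fail)+,
       force intro!: analytic_intros,
       simp,
       simp add: powr_half_multiple_squared power_mult_distrib flip: power_mult,
       (simp add: numeral_fps_const fps_power_zeroth; fail)+,
       (simp only: euler_eval of_nat_numeral of_nat_1 power_one, algebra)+)
qed

lemma F2_germ_5:
  "common_germ (\<lambda>p. 1 / ((1 + 4*p^2) powr (1/2) * (1 - 2*p - 4*p^2))
    * F2 (p^5 * (1 + p) * (1 - 4*p) / ((1 + 4*p^2)^2 * (1 - 2*p - 4*p^2)^4)))"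
proof -
  define p :: "complex fps" where "p = fps_X"
  show ?thesis
  proof (rule F2_germI[where e = 5 and \<beta> = "\<lambda>p. (1 + 4*p^2) * (1 - 2*p - 4*p^2)^2" and b = "(1 + 4*p^2) * (1 - 2*p - 4*p^2)^2"
      and M = "((1 + 4*p^2)^2 * (1 - 2*p - 4*p^2)^4)" and N = "p^5 * (1 + p) * (1 - 4*p)"
      and g = "(1 + p) * (1 - 4*p) * (1 + 4*p^2) * (1 - 2*p - 4*p^2)"
      and R = "5 - 20*p - 320*p^5 - 320*p^6"])
  qed (unfold p_def common_S_def common_Q_def,
       (intro fps_expansion_intros; fail)+,
       force intro!: analytic_intros,
       simp,
       simp add: powr_half_multiple_squared power_mult_distrib flip: power_mult,
       (simp add: numeral_fps_const fps_power_zeroth; fail)+,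
       (simp only: euler_eval of_nat_numeral of_nat_1 power_one, algebra)+)
qed

lemma F4_germ_1:
  "common_germ (\<lambda>p. 1 / (1 - 4*p) powr (5/2)
    * F4 (- p * ((1 + p) / (1 - 4*p))^5))"
proof -
  define p :: "complex fps" where "p = fps_X"
  have "common_germ (\<lambda>p. 1 / (1 - 4*p) powr (5/2)
    * F4 (- p * (1 + p)^5 / (1 - 4*p)^5))"
  proof (rule F4_germI[where e = 1 and \<beta> = "\<lambda>p. (1 - 4*p)^5" and b = "(1 - 4*p)^5"
      and M = "(1 - 4*p)^5" and N = "- p * (1 + p)^5"
      and g = "(1 + p) * (1 - 4*p)"
      and R = "1 + 22*p - 4*p^2"])
  qed (unfold p_def common_S_def common_Q_def,
       (intro fps_expansion_intros; fail)+,
       force intro!: analytic_intros,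
       simp,
       simp add: powr_half_multiple_squared power_mult_distrib flip: power_mult,
       (simp add: numeral_fps_const fps_power_zeroth; fail)+,
       (simp only: euler_eval of_nat_numeral of_nat_1 power_one, algebra)+)
  then show ?thesis by (simp add: power_divide)
qed

lemma F4_germ_5:
  "common_germ (\<lambda>p. 1 / (1 - 4*p) powr (1/2)
    * F4 (- (p^5) * ((1 + p) / (1 - 4*p))))"
proof -
  define p :: "complex fps" where "p = fps_X"
  have "common_germ (\<lambda>p. 1 / (1 - 4*p) powr (1/2)
    * F4 (- (p^5) * (1 + p) / (1 - 4*p)))"
  proof (rule F4_germI[where e = 5 and \<beta> = "\<lambda>p. (1 - 4*p)" and b = "(1 - 4*p)"
      and M = "(1 - 4*p)" and N = "- (p^5) * (1 + p)"
      and g = "(1 + p) * (1 - 4*p)"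
      and R = "5 - 10*p - 20*p^2"])
  qed (unfold p_def common_S_def common_Q_def,
       (intro fps_expansion_intros; fail)+,
       force intro!: analytic_intros,
       simp,
       simp add: powr_half_multiple_squared power_mult_distrib flip: power_mult,
       (simp add: numeral_fps_const fps_power_zeroth; fail)+,
       (simp only: euler_eval of_nat_numeral of_nat_1 power_one, algebra)+)
  then show ?thesis by (simp add: power_divide)
qed

lemma F5_germ_1:
  "common_germ (\<lambda>p. 1 / ((1 + 4*p^2) powr (1/2) * (1 + 4*p + 8*p^2))
    * F5 (p * (1 - 4*p)^2 * (1 + p) / ((1 + 4*p^2) * (1 + 4*p + 8*p^2)^2)))"
proof -
  define p :: "complex fps" where "p = fps_X"
  show ?thesis
  proof (rule F5_germI[where e = 1 and \<beta> = "\<lambda>p. (1 + 4*p^2) * (1 + 4*p + 8*p^2)^2" and b = "(1 + 4*p^2) * (1 + 4*p + 8*p^2)^2"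
      and M = "((1 + 4*p^2) * (1 + 4*p + 8*p^2)^2)" and N = "p * (1 - 4*p)^2 * (1 + p)"
      and g = "(1 + p) * (1 - 4*p) * (1 + 4*p^2) * (1 + 4*p + 8*p^2)"
      and R = "1 - 14*p - 60*p^2 - 80*p^3 - 160*p^4 + 256*p^5 + 256*p^6"])
  qed (unfold p_def common_S_def common_Q_def,
       (intro fps_expansion_intros; fail)+,
       force intro!: analytic_intros,
       simp,
       simp add: powr_half_multiple_squared power_mult_distrib flip: power_mult,
       (simp add: numeral_fps_const fps_power_zeroth; fail)+,
       (simp only: euler_eval of_nat_numeral of_nat_1 power_one, algebra)+)
qed

lemma F5_germ_2:
  "common_germ (\<lambda>p. 1 / ((1 + 4*p^2) powr (1/2) * (1 - 2*p + 2*p^2))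
    * F5 (p^2 * (1 - 4*p) * (1 + p)^2 / ((1 + 4*p^2) * (1 - 2*p + 2*p^2)^2)))"
proof -
  define p :: "complex fps" where "p = fps_X"
  show ?thesis
  proof (rule F5_germI[where e = 2 and \<beta> = "\<lambda>p. (1 + 4*p^2) * (1 - 2*p + 2*p^2)^2" and b = "(1 + 4*p^2) * (1 - 2*p + 2*p^2)^2"
      and M = "((1 + 4*p^2) * (1 - 2*p + 2*p^2)^2)" and N = "p^2 * (1 - 4*p) * (1 + p)^2"
      and g = "(1 + p) * (1 - 4*p) * (1 + 4*p^2) * (1 - 2*p + 2*p^2)"
      and R = "2 - 8*p - 20*p^2 + 40*p^3 - 120*p^4 + 112*p^5 + 32*p^6"])
  qed (unfold p_def common_S_def common_Q_def,
       (intro fps_expansion_intros; fail)+,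
       force intro!: analytic_intros,
       simp,
       simp add: powr_half_multiple_squared power_mult_distrib flip: power_mult,
       (simp add: numeral_fps_const fps_power_zeroth; fail)+,
       (simp only: euler_eval of_nat_numeral of_nat_1 power_one, algebra)+)
qed

lemma G5_germ_1:
  "common_germ (\<lambda>p. 1 / ((1 + p) * (1 - 4*p)^2)
    * G5 (p / (1 + p) * (1 / (1 - 4*p))^2))"
proof -
  define p :: "complex fps" where "p = fps_X"
  have "common_germ (\<lambda>p. 1 / ((1 + p) * (1 - 4*p)^2)
    * G5 (p / ((1 + p) * (1 - 4*p)^2)))"
  proof (rule G5_germI[where e = 1 and \<beta> = "\<lambda>p. (1 + p)^2 * (1 - 4*p)^4" and b = "(1 + p)^2 * (1 - 4*p)^4"
      and M = "((1 + p) * (1 - 4*p)^2)" and N = "p"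
      and g = "(1 + p) * (1 - 4*p)"
      and R = "1 + 4*p + 8*p^2"])
  qed (unfold p_def common_S_def common_Q_def,
       (intro fps_expansion_intros; fail)+,
       force intro!: analytic_intros,
       simp,
       simp add: powr_half_multiple_squared power_mult_distrib flip: power_mult,
       (simp add: numeral_fps_const fps_power_zeroth; fail)+,
       (simp only: euler_eval of_nat_numeral of_nat_1 power_one, algebra)+)
  then show ?thesis by (simp add: power_divide)
qed

lemma G5_germ_2:
  "common_germ (\<lambda>p. 1 / ((1 + p)^2 * (1 - 4*p))
    * G5 ((p / (1 + p))^2 * (1 / (1 - 4*p))))"
proof -
  define p :: "complex fps" where "p = fps_X"
  have "common_germ (\<lambda>p. 1 / ((1 + p)^2 * (1 - 4*p))
    * G5 (p^2 / ((1 + p)^2 * (1 - 4*p))))"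
  proof (rule G5_germI[where e = 2 and \<beta> = "\<lambda>p. (1 + p)^4 * (1 - 4*p)^2" and b = "(1 + p)^4 * (1 - 4*p)^2"
      and M = "((1 + p)^2 * (1 - 4*p))" and N = "p^2"
      and g = "(1 + p) * (1 - 4*p)"
      and R = "2 - 4*p + 4*p^2"])
  qed (unfold p_def common_S_def common_Q_def,
       (intro fps_expansion_intros; fail)+,
       force intro!: analytic_intros,
       simp,
       simp add: powr_half_multiple_squared power_mult_distrib flip: power_mult,
       (simp add: numeral_fps_const fps_power_zeroth; fail)+,
       (simp only: euler_eval of_nat_numeral of_nat_1 power_one, algebra)+)
  then show ?thesis by (simp add: power_divide)
qed

lemma H_germ_1:
  "common_germ (\<lambda>p. 1 / (1 + 4*p^2) powr (3/2)
    * H (p * (1 + p) * (1 - 4*p) / (1 + 4*p^2)^2))"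
proof -
  define p :: "complex fps" where "p = fps_X"
  show ?thesis
  proof (rule H_germI[where e = 1 and \<beta> = "\<lambda>p. (1 + 4*p^2)^3" and b = "(1 + 4*p^2)^3"
      and M = "(1 + 4*p^2)^2" and N = "p * (1 + p) * (1 - 4*p)"
      and g = "(1 + p) * (1 - 4*p) * (1 + 4*p^2)"
      and R = "1 - 6*p - 24*p^2 + 24*p^3 + 16*p^4"])
  qed (unfold p_def common_S_def common_Q_def,
       (intro fps_expansion_intros; fail)+,
       force intro!: analytic_intros,
       simp,
       simp add: powr_half_multiple_squared power_mult_distrib flip: power_mult,
       (simp add: numeral_fps_const fps_power_zeroth; fail)+,
       (simp only: euler_eval of_nat_numeral of_nat_1 power_one, algebra)+)
qed

section \<open>The equality of the thirteen functions\<close>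

theorem theorem5p1:
  shows "\<exists>Z :: complex \<Rightarrow> complex. \<forall>\<^sub>F p in nhds 0.
     Z p = 1 / (1 + 236*p + 1440*p^2 + 1920*p^3 + 3840*p^4 + 256*p^5 + 256*p^6) powr (1/2)
           * F1 (p * (1 - 4*p)^10 * (1 + p)^5
                 / (1 + 236*p + 1440*p^2 + 1920*p^3 + 3840*p^4 + 256*p^5 + 256*p^6)^3)
   \<and> Z p = 1 / (1 - 4*p + 240*p^2 - 480*p^3 + 1440*p^4 - 944*p^5 + 16*p^6) powr (1/2)
           * F1 (p^2 * (1 - 4*p)^5 * (1 + p)^10
                 / (1 - 4*p + 240*p^2 - 480*p^3 + 1440*p^4 - 944*p^5 + 16*p^6)^3)
   \<and> Z p = 1 / (1 - 4*p + 256*p^5 + 256*p^6) powr (1/2)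
           * F1 (p^5 * (1 - 4*p)^2 * (1 + p) / (1 - 4*p + 256*p^5 + 256*p^6)^3)
   \<and> Z p = 1 / (1 - 4*p + 16*p^5 + 16*p^6) powr (1/2)
           * F1 (p^10 * (1 - 4*p) * (1 + p)^2 / (1 - 4*p + 16*p^5 + 16*p^6)^3)
   \<and> Z p = 1 / ((1 + 4*p^2) powr (1/2) * (1 + 22*p - 4*p^2))
           * F2 (p * (1 + p)^5 * (1 - 4*p)^5 / ((1 + 4*p^2)^2 * (1 + 22*p - 4*p^2)^4))
   \<and> Z p = 1 / ((1 + 4*p^2) powr (1/2) * (1 - 2*p - 4*p^2))
           * F2 (p^5 * (1 + p) * (1 - 4*p) / ((1 + 4*p^2)^2 * (1 - 2*p - 4*p^2)^4))
   \<and> Z p = 1 / (1 - 4*p) powr (5/2) * F4 (- p * ((1 + p) / (1 - 4*p))^5)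
   \<and> Z p = 1 / (1 - 4*p) powr (1/2) * F4 (- (p^5) * ((1 + p) / (1 - 4*p)))
   \<and> Z p = 1 / ((1 + 4*p^2) powr (1/2) * (1 + 4*p + 8*p^2))
           * F5 (p * (1 - 4*p)^2 * (1 + p) / ((1 + 4*p^2) * (1 + 4*p + 8*p^2)^2))
   \<and> Z p = 1 / ((1 + 4*p^2) powr (1/2) * (1 - 2*p + 2*p^2))
           * F5 (p^2 * (1 - 4*p) * (1 + p)^2 / ((1 + 4*p^2) * (1 - 2*p + 2*p^2)^2))
   \<and> Z p = 1 / ((1 + p) * (1 - 4*p)^2) * G5 (p / (1 + p) * (1 / (1 - 4*p))^2)
   \<and> Z p = 1 / ((1 + p)^2 * (1 - 4*p)) * G5 ((p / (1 + p))^2 * (1 / (1 - 4*p)))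
   \<and> Z p = 1 / (1 + 4*p^2) powr (3/2) * H (p * (1 + p) * (1 - 4*p) / (1 + 4*p^2)^2)"
proof -
  define Z where "Z = (\<lambda>p. 1 / eisenstein_1 p powr (1/2) 
    * F1 (p * (1 - 4*p)^10 * (1 + p)^5 / eisenstein_1 p ^ 3))"
  have ev: "\<forall>\<^sub>F p in nhds 0. Z p = f p" if "common_germ f" for f
    unfolding Z_def by (rule common_germ_unique[OF F1_germ_1 that])
  show ?thesis
    unfolding eventually_conj_iff
    by (intro exI[of _ Z] conjI
          ev[OF F1_germ_1, unfolded eisenstein_1_def] ev[OF F1_germ_2, unfolded eisenstein_2_def]
          ev[OF F1_germ_5, unfolded eisenstein_5_def] ev[OF F1_germ_10, unfolded eisenstein_10_def]
          ev[OF F2_germ_1] ev[OF F2_germ_5] ev[OF F4_germ_1] ev[OF F4_germ_5] 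
          ev[OF F5_germ_1] ev[OF F5_germ_2] ev[OF G5_germ_1] ev[OF G5_germ_2] ev[OF H_germ_1])
qed

end
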